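(* Let $k\ge2$ be an integer. If $G$ is a nontrivial linear reversible gate on $n$ bits that preserves Hamming weight mod $k$, i.e. $|G(x)|\equiv|x|\pmod k$ for all $x\in\{0,1\}^n$, then either $k=2$ or $k=4$.
   Context: A linear reversible gate on $n$ bits is a map $G(x)=Ax$ on $\mathbb{F}_2^n=\{0,1\}^n$ with $A\in\mathbb{F}_2^{n\times n}$ invertible. It is nontrivial if it is not merely a permutation of the $n$ input bits (i.e. $A$ is not a permutation matrix). $|x|$ denotes Hamming weight. *)

theory Defs
  imports "HOL-Analysis.Analysis" "HOL-Library.Z2" "HOL-Number_Theory.Cong"
begin

text \<open>Bit strings of length \<open>n\<close> are vectors over the two-element field \<^typ>\<open>bit\<close>, indexed by a finite
  type with \<open>n\<close> elements.\<close>

definition hamming_weight :: "bit ^ 'n \<Rightarrow> nat" where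
  "hamming_weight x = card {i. x $ i = 1}"

definition linear_reversible_gate :: "(bit ^ 'n \<Rightarrow> bit ^ 'n) \<Rightarrow> bool" where
  "linear_reversible_gate G \<longleftrightarrow> (\<exists>A :: bit ^ 'n ^ 'n. invertible A \<and> G = (\<lambda>x. A *v x))"

definition permutation_matrix :: "'a::zero_neq_one ^ 'n ^ 'n \<Rightarrow> bool" where
  "permutation_matrix A \<longleftrightarrow> (\<exists>p. p permutes UNIV \<and> A = (\<chi> i j. if j = p i then 1 else 0))"

definition nontrivial_gate :: "(bit ^ 'n \<Rightarrow> bit ^ 'n) \<Rightarrow> bool" where
  "nontrivial_gate G \<longleftrightarrow> \<not> (\<exists>p. p permutes UNIV \<and> G = (\<lambda>x. \<chi> i. x $ p i))"

definition preserves_weight_mod :: "nat \<Rightarrow> (bit ^ 'n \<Rightarrow> bit ^ 'n) \<Rightarrow> bool" where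
  "preserves_weight_mod k G \<longleftrightarrow> (\<forall>x. [hamming_weight (G x) = hamming_weight x] (mod k))"

lemma nontrivial_gate_matrix:
  fixes A :: "bit ^ 'n ^ 'n"
  shows "nontrivial_gate (\<lambda>x. A *v x) \<longleftrightarrow> \<not> permutation_matrix A"
proof -
  have perm: "(\<chi> i j. if j = p i then 1 else 0) *v x = (\<chi> i. x $ p i)"
    for p :: "'n \<Rightarrow> 'n" and x :: "bit ^ 'n"
  proof -
    have "(\<Sum>j\<in>UNIV. (if j = p i then 1 else 0) * x $ j) = (\<Sum>j\<in>UNIV. if j = p i then x $ j else 0)" for i
      by (rule sum.cong) simp_all
    then show ?thesis
      by (simp only: vec_eq_iff matrix_vector_mult_def vec_lambda_beta sum.delta finite_class.finite_UNIV UNIV_I if_True simp_thms)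
  qed
  have "(\<lambda>x. A *v x) = (\<lambda>x. \<chi> i. x $ p i) \<longleftrightarrow> A = (\<chi> i j. if j = p i then 1 else 0)"
    for p :: "'n \<Rightarrow> 'n"
    unfolding matrix_eq perm [symmetric] fun_eq_iff ..
  then show ?thesis
    by (simp add: nontrivial_gate_def permutation_matrix_def)
qed

end

theory Submission
  imports Defs
begin

text \<open>Expanding \<open>|u + v + w|\<close> by inclusion-exclusion expresses \<open>4 |u \<and> v \<and> w|\<close> through weights of sums
  of \<open>u\<close>, \<open>v\<close>, \<open>w\<close>, so a linear map preserving weights mod \<open>k\<close> also preserves \<open>4 |u \<and> v \<and> w|\<close> mod \<open>k\<close>.
  If two distinct columns \<open>G e\<^sub>i\<close>, \<open>G e\<^sub>j\<close> share a 1 in position \<open>r\<close>, taking \<open>w = G\<^sup>-\<^sup>1 e\<^sub>r\<close> gives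
  \<open>4 \<equiv> 4 |e\<^sub>i \<and> e\<^sub>j \<and> w| = 0\<close>, i.e.\ \<open>k\<close> divides 4. Otherwise the columns of the invertible matrix
  have disjoint supports, which makes it a permutation matrix.\<close>

definition triple_overlap :: "bit ^ 'n \<Rightarrow> bit ^ 'n \<Rightarrow> bit ^ 'n \<Rightarrow> nat" where
  "triple_overlap u v w = card {i. u $ i = 1 \<and> v $ i = 1 \<and> w $ i = 1}"

lemma int_card_Collect:
  "int (card {i::'n::finite. P i}) = (\<Sum>i\<in>UNIV. if P i then 1 else 0)"
  by (simp add: sum.If_cases)

text \<open>The identity holds position by position, by checking the eight values of three bits.
  Working in \<open>int\<close> makes the subtractions genuine.\<close>

lemma four_triple_overlap:
  fixes u v w :: "bit ^ 'n"
  shows "4 * int (triple_overlap u v w) =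
    int (hamming_weight u) + int (hamming_weight v) + int (hamming_weight w)
    - int (hamming_weight (u + v)) - int (hamming_weight (u + w)) - int (hamming_weight (v + w))
    + int (hamming_weight (u + v + w))"
  unfolding triple_overlap_def hamming_weight_def int_card_Collect
    sum_distrib_left sum.distrib [symmetric] sum_subtractf [symmetric]
proof (rule sum.cong)
  fix i
  show "4 * (if u $ i = 1 \<and> v $ i = 1 \<and> w $ i = 1 then 1 else 0) =
    (if u $ i = 1 then 1 else 0) + (if v $ i = 1 then 1 else 0) + (if w $ i = 1 then 1 else 0)
    - (if (u + v) $ i = 1 then 1 else 0) - (if (u + w) $ i = 1 then 1 else 0)
    - (if (v + w) $ i = 1 then 1 else 0) + (if (u + v + w) $ i = 1 then 1 else (0::int))"
    by (cases "u $ i"; cases "v $ i"; cases "w $ i") simp_all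
qed simp

text \<open>The factor 4 cannot be cancelled mod \<open>k\<close> in general; it is the source of
  the final \<open>k dvd 4\<close>.\<close>

lemma preserves_weight_mod_triple_overlap:
  fixes A :: "bit ^ 'n ^ 'n"
  assumes "preserves_weight_mod k (\<lambda>x. A *v x)"
  shows "[4 * triple_overlap (A *v u) (A *v v) (A *v w) = 4 * triple_overlap u v w] (mod k)"
proof -
  have weight: "[int (hamming_weight (A *v x)) = int (hamming_weight x)] (mod int k)" for x
    using assms by (simp add: preserves_weight_mod_def cong_int_iff)
  have "[4 * int (triple_overlap (A *v u) (A *v v) (A *v w)) = 4 * int (triple_overlap u v w)] (mod int k)"
    \<comment> \<open>By linearity each sum of images is the image of a sum, so all seven weights
      are preserved mod \<open>k\<close>.\<close>
    unfolding four_triple_overlap matrix_vector_right_distrib [symmetric]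
    by (intro cong_add cong_diff weight)
  then show ?thesis
    by (metis cong_int_iff of_nat_mult of_nat_numeral)
qed

text \<open>Invertibility excludes zero rows and columns, so each row has exactly one 1; its column
  index defines the permutation.\<close>

lemma permutation_matrix_if_disjoint_columns:
  fixes A :: "bit ^ 'n ^ 'n"
  assumes "invertible A"
    and disjoint: "\<And>r i j. A $ r $ i = 1 \<Longrightarrow> A $ r $ j = 1 \<Longrightarrow> i = j"
  shows "permutation_matrix A"
proof -
  obtain B where B: "A ** B = mat 1" "B ** A = mat 1"
    using \<open>invertible A\<close> by (auto simp: invertible_def)
  have row: "\<exists>j. A $ r $ j = 1" for r
  proof (rule ccontr)
    assume "\<nexists>j. A $ r $ j = 1"
    then have "A $ r $ j = 0" for j
      by simp
    then have "(A ** B) $ r $ r = 0"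
      by (simp add: matrix_matrix_mult_def)
    then show False
      by (simp add: B mat_def)
  qed
  have col: "\<exists>r. A $ r $ j = 1" for j
  proof (rule ccontr)
    assume "\<nexists>r. A $ r $ j = 1"
    then have "A $ r $ j = 0" for r
      by simp
    then have "(B ** A) $ j $ j = 0"
      by (simp add: matrix_matrix_mult_def)
    then show False
      by (simp add: B mat_def)
  qed
  obtain p where p: "\<And>r. A $ r $ p r = 1"
    using row by metis
  have "surj p"
    \<comment> \<open>If column \<open>j\<close> has a 1 in row \<open>r\<close>, then
      \<open>disjoint\<close> forces \<open>p r = j\<close>.\<close>
    using col disjoint p by (metis surjI)
  then have "bij p"
    by (simp add: bij_def finite_UNIV_surj_inj)
  then have "p permutes UNIV"
    by (rule bij_imp_permutes) simp
  moreover have "A $ r $ j = (if j = p r then 1 else 0)" for r j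
    using p disjoint by (cases "A $ r $ j") auto
  then have "A = (\<chi> i j. if j = p i then 1 else 0)"
    by (simp add: vec_eq_iff)
  ultimately show ?thesis
    by (auto simp: permutation_matrix_def)
qed

theorem theorem19:
  fixes k :: nat and G :: "bit ^ 'n \<Rightarrow> bit ^ 'n"
  assumes "k \<ge> 2"
    and "linear_reversible_gate G"
    and "nontrivial_gate G"
    and "preserves_weight_mod k G"
  shows "k = 2 \<or> k = 4"
proof -
  obtain A where "invertible A" and G: "G = (\<lambda>x. A *v x)"
    using assms(2) by (auto simp: linear_reversible_gate_def)
  then obtain B where B: "A ** B = mat 1"
    by (auto simp: invertible_def)
  have "\<not> permutation_matrix A"
    using assms(3) by (simp add: G nontrivial_gate_matrix)
  then obtain r i j where r: "A $ r $ i = 1" "A $ r $ j = 1" and "i \<noteq> j"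
    using permutation_matrix_if_disjoint_columns \<open>invertible A\<close> by blast
  let ?w = "B *v axis r 1"
  have w: "A *v ?w = axis r 1"
    by (simp add: matrix_vector_mul_assoc B)
  have column: "(A *v axis l 1) $ s = A $ s $ l" for l s
  proof -
    have "(A *v axis l 1) $ s = (\<Sum>t\<in>UNIV. if t = l then A $ s $ t else 0)"
      unfolding matrix_vector_mult_def axis_def vec_lambda_beta by (rule sum.cong) simp_all
    then show ?thesis
      by simp
  qed
  \<comment> \<open>The third image, a basis vector, confines the overlap to position
    \<open>r\<close>.\<close>
  have "{s. A $ s $ i = 1 \<and> A $ s $ j = 1 \<and> axis r (1::bit) $ s = 1} = {r}"
    using r by (auto simp: axis_def split: if_splits)
  then have "triple_overlap (A *v axis i 1) (A *v axis j 1) (A *v ?w) = 1"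
    by (simp add: triple_overlap_def w column)
  moreover have "triple_overlap (axis i 1) (axis j 1) ?w = 0"
    using \<open>i \<noteq> j\<close> by (auto simp: triple_overlap_def axis_def)
  ultimately have "[4 = 0] (mod k)"
    using preserves_weight_mod_triple_overlap [of k A "axis i 1" "axis j 1" ?w] assms(4)
    by (simp add: G)
  then have "k dvd 4"
    by (simp add: cong_0_iff)
  then have "k \<le> 4"
    by (simp add: dvd_imp_le)
  with \<open>k \<ge> 2\<close> have "k = 2 \<or> k = 3 \<or> k = 4"
    by linarith
  with \<open>k dvd 4\<close> show ?thesis
    by auto
qed

end
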